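(* Let $F=\mathbb{F}_q$, $q=2^r$, and let $(F,+,\circ)$ be a symplectic presemifield with multiplication written uniquely as $x\circ y=\sum_{i,j=0}^{r-1}a_{ij}x^{2^i}y^{2^j}$. Then the bases $$B_\infty=\{e_w\mid w\in F\},\qquad B_m=\{b_{m,v}\mid v\in F\}\ (m\in F),\qquad b_{m,v}=\frac{1}{\sqrt q}\sum_{w\in F}\omega^{{\rm Tr}(\hat w\cdot(\hat w\circ\hat m)+2\hat w\hat v)}e_w,$$ form a complete set of mutually unbiased bases of $\mathbb{C}^q$.
   Context: $\omega\in\mathbb{C}$ is a primitive $4$th root of unity (so $\omega^a$, $a\in\mathbb{Z}_4$, is well defined), and $\{e_w\}_{w\in F}$ is the standard basis of $\mathbb{C}^q$. ${\rm tr}:\mathbb{F}_q\to\mathbb{F}_2$ is the absolute trace. A presemifield $(F,+,\circ)$ is the additive group of $F$ with a multiplication $\circ$, left and right distributive over $+$, with no zero divisors; it is symplectic if each subspace $\{(0,y)\mid y\in F\}$ and $\{(x,x\circ y)\mid x\in F\}$ ($y\in F$) of $F\oplus F$ is totally isotropic for the form $\langle(u,v),(u',v')\rangle={\rm tr}(uv'-vu')$. $R=GR(4^r)$ is the Galois ring of characteristic $4$ and order $4^r$ ($R/2R\cong\mathbb{F}_q$), $\mathcal{T}=\{0\}\cup C$ its Teichmüller set ($C$ the cyclic subgroup of order $2^r-1$ of $R^*$), $\hat u\in\mathcal{T}$ the Teichmüller lift of $u\in F$. For $x=a+2b$ ($a,b\in\mathcal{T}$), ${\rm Tr}(x)=\sum_{i=0}^{r-1}(a^{2^i}+2b^{2^i})\in\mathbb{Z}_4$.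 The extension of $\circ$ is $\hat x\circ\hat y=\sum_{i,j}\widehat{a_{ij}}\hat x^{2^i}\hat y^{2^j}$. A complete set of MUBs of $\mathbb{C}^q$ is a set of $q+1$ orthonormal bases with $|(x,y)|^2=1/q$ for $x,y$ in distinct bases. *)

theory Defs
  imports "HOL-Analysis.Analysis" "HOL-Computational_Algebra.Computational_Algebra"
begin

section \<open>Symplectic presemifields\<close>

definition presemifield :: "('f::finite_field \<Rightarrow> 'f \<Rightarrow> 'f) \<Rightarrow> bool" where
  "presemifield mul \<longleftrightarrow>
     (\<forall>x y z. mul (x + y) z = mul x z + mul y z) \<and>
     (\<forall>x y z. mul x (y + z) = mul x y + mul x z) \<and>
     (\<forall>x y. mul x y = 0 \<longrightarrow> x = 0 \<or> y = 0)"

text \<open>The absolute trace of the field of order \<open>2 ^ r\<close>. Its values lie in the prime field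
  \<open>{0, 1}\<close>, which is kept as a subset of the big field.\<close>

definition abs_trace :: "nat \<Rightarrow> 'f::finite_field \<Rightarrow> 'f" where
  "abs_trace r x = (\<Sum>i<r. x ^ (2 ^ i))"

definition symp_form :: "nat \<Rightarrow> 'f::finite_field \<times> 'f \<Rightarrow> 'f \<times> 'f \<Rightarrow> 'f" where
  "symp_form r p p' = abs_trace r (fst p * snd p' - snd p * fst p')"

definition totally_isotropic :: "nat \<Rightarrow> ('f::finite_field \<times> 'f) set \<Rightarrow> bool" where
  "totally_isotropic r S \<longleftrightarrow> (\<forall>p\<in>S. \<forall>p'\<in>S. symp_form r p p' = 0)"

definition symplectic_presemifield :: "nat \<Rightarrow> ('f::finite_field \<Rightarrow> 'f \<Rightarrow> 'f) \<Rightarrow> bool" where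
  "symplectic_presemifield r mul \<longleftrightarrow>
     presemifield mul \<and>
     totally_isotropic r {(0 :: 'f, y) | y. True} \<and>
     (\<forall>y. totally_isotropic r {(x, mul x y) | x. True})"

text \<open>Only the coefficients with both indices below \<open>r\<close> are meaningful; the others are
  normalised to zero so that uniqueness of the expansion can be stated.\<close>

definition has_expansion ::
    "nat \<Rightarrow> ('f::finite_field \<Rightarrow> 'f \<Rightarrow> 'f) \<Rightarrow> (nat \<Rightarrow> nat \<Rightarrow> 'f) \<Rightarrow> bool" where
  "has_expansion r mul a \<longleftrightarrow>
     (\<forall>i j. i \<ge> r \<or> j \<ge> r \<longrightarrow> a i j = 0) \<and>
     (\<forall>x y. mul x y = (\<Sum>i<r. \<Sum>j<r. a i j * x ^ (2 ^ i) * y ^ (2 ^ j)))"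


section \<open>The Galois ring of characteristic 4 and order \<open>4 ^ r\<close>\<close>

text \<open>\<open>red\<close> is a fixed identification of \<open>R / 2R\<close> with the field, given as a surjective ring
  homomorphism with kernel \<open>2R\<close>. A finite commutative ring of characteristic 4 admitting
  such a map is local with maximal ideal \<open>2R\<close>, that is, a Galois ring.\<close>

definition galois_ring_4 :: "nat \<Rightarrow> ('r::{comm_ring_1,finite} \<Rightarrow> 'f::finite_field) \<Rightarrow> bool" where
  "galois_ring_4 r red \<longleftrightarrow>
     CHAR('r) = 4 \<and> CARD('r) = 4 ^ r \<and>
     red 1 = 1 \<and>
     (\<forall>x y. red (x + y) = red x + red y) \<and>
     (\<forall>x y. red (x * y) = red x * red y) \<and>
     surj red \<and>
     {x. red x = 0} = range (\<lambda>x. 2 * x)"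

text \<open>In a finite ring the powers of a unit \<open>g\<close> with natural exponents form the cyclic
  subgroup of the unit group generated by \<open>g\<close>.\<close>

definition teichmueller_group :: "nat \<Rightarrow> 'r::{comm_ring_1,finite} set" where
  "teichmueller_group r =
     (THE C. (\<exists>g. g dvd 1 \<and> C = range (\<lambda>k::nat. g ^ k)) \<and> card C = 2 ^ r - 1)"

definition teichmueller_set :: "nat \<Rightarrow> 'r::{comm_ring_1,finite} set" where
  "teichmueller_set r = insert 0 (teichmueller_group r)"

definition teichmueller_lift ::
    "nat \<Rightarrow> ('r::{comm_ring_1,finite} \<Rightarrow> 'f::finite_field) \<Rightarrow> 'f \<Rightarrow> 'r" where
  "teichmueller_lift r red u = (THE t. t \<in> teichmueller_set r \<and> red t = u)"

text \<open>The pair \<open>(a, b)\<close> of Teichmueller elements with \<open>x = a + 2 * b\<close>.\<close>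

definition teichmueller_parts :: "nat \<Rightarrow> 'r::{comm_ring_1,finite} \<Rightarrow> 'r \<times> 'r" where
  "teichmueller_parts r x =
     (THE p. fst p \<in> teichmueller_set r \<and> snd p \<in> teichmueller_set r \<and> x = fst p + 2 * snd p)"

text \<open>The trace, as an element of the Galois ring; its values lie in the subring
  \<open>{0, 1, 2, 3}\<close>, the copy of the integers modulo 4.\<close>

definition galois_trace :: "nat \<Rightarrow> 'r::{comm_ring_1,finite} \<Rightarrow> 'r" where
  "galois_trace r x =
     (let (a, b) = teichmueller_parts r x in \<Sum>i<r. a ^ (2 ^ i) + 2 * b ^ (2 ^ i))"

text \<open>The power of \<open>\<omega>\<close> with exponent in that copy of the integers modulo 4.\<close>

definition z4_pow :: "complex \<Rightarrow> 'r::{comm_ring_1,finite} \<Rightarrow> complex" where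
  "z4_pow \<omega> z = \<omega> ^ (THE k::nat. k < 4 \<and> of_nat k = z)"

definition ext_mul ::
    "nat \<Rightarrow> ('r::{comm_ring_1,finite} \<Rightarrow> 'f::finite_field) \<Rightarrow> (nat \<Rightarrow> nat \<Rightarrow> 'f) \<Rightarrow> 'r \<Rightarrow> 'r \<Rightarrow> 'r" where
  "ext_mul r red a X Y =
     (\<Sum>i<r. \<Sum>j<r. teichmueller_lift r red (a i j) * X ^ (2 ^ i) * Y ^ (2 ^ j))"


section \<open>Mutually unbiased bases\<close>

definition herm :: "complex ^ 'n \<Rightarrow> complex ^ 'n \<Rightarrow> complex" where
  "herm x y = (\<Sum>w\<in>UNIV. x $ w * cnj (y $ w))"

definition orthonormal_basis :: "(complex ^ 'n) set \<Rightarrow> bool" where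
  "orthonormal_basis B \<longleftrightarrow>
     vec.independent B \<and> vec.span B = UNIV \<and>
     (\<forall>x\<in>B. \<forall>y\<in>B. herm x y = (if x = y then 1 else 0))"

definition complete_set_of_MUBs :: "(complex ^ 'n) set set \<Rightarrow> bool" where
  "complete_set_of_MUBs \<B> \<longleftrightarrow>
     card \<B> = CARD('n) + 1 \<and>
     (\<forall>B\<in>\<B>. orthonormal_basis B) \<and>
     (\<forall>B\<in>\<B>. \<forall>B'\<in>\<B>. B \<noteq> B' \<longrightarrow>
        (\<forall>x\<in>B. \<forall>y\<in>B'. (cmod (herm x y))\<^sup>2 = 1 / real CARD('n)))"

definition primitive_4th_root :: "complex \<Rightarrow> bool" where
  "primitive_4th_root \<omega> \<longleftrightarrow> \<omega> ^ 4 = 1 \<and> (\<forall>k::nat. 0 < k \<and> k < 4 \<longrightarrow> \<omega> ^ k \<noteq> 1)"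


section \<open>The bases attached to a presemifield\<close>

definition basis_infinity :: "(complex, 'f::finite_field) vec set" where
  "basis_infinity = {axis w 1 | w. True}"

definition basis_vec ::
    "complex \<Rightarrow> nat \<Rightarrow> ('r::{comm_ring_1,finite} \<Rightarrow> 'f::finite_field) \<Rightarrow> (nat \<Rightarrow> nat \<Rightarrow> 'f)
      \<Rightarrow> 'f \<Rightarrow> 'f \<Rightarrow> (complex, 'f) vec" where
  "basis_vec \<omega> r red a m v =
     complex_of_real (1 / sqrt (real CARD('f))) *s
       (\<Sum>w\<in>UNIV. z4_pow \<omega> (galois_trace r
          (teichmueller_lift r red w *
             ext_mul r red a (teichmueller_lift r red w) (teichmueller_lift r red m)
           + 2 * teichmueller_lift r red w * teichmueller_lift r red v)) *s axis w 1)"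

definition basis_of ::
    "complex \<Rightarrow> nat \<Rightarrow> ('r::{comm_ring_1,finite} \<Rightarrow> 'f::finite_field) \<Rightarrow> (nat \<Rightarrow> nat \<Rightarrow> 'f)
      \<Rightarrow> 'f \<Rightarrow> (complex, 'f) vec set" where
  "basis_of \<omega> r red a m = {basis_vec \<omega> r red a m v | v. True}"

end

(* For fixed m the exponent Tr(w * (w o m)) is a Z_4-valued quadratic form on F: its polarization
   is 2 tr(u (w o m)). Indeed, the lift of w + u differs from the sum of the lifts by twice a
   Teichmueller element, and since the symplectic condition is a multiplicative identity between the
   coefficients a_ij, it lifts to the Galois ring and makes the bilinear form Tr(x * (y o m))
   symmetric modulo 4, so the correction terms are multiples of 4. An inner product of vectors from
   B_m and B_m' is thus a Gauss sum whose quadratic phase has polarization tr(u (w o (m + m'))).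
   This is nondegenerate because o has no zero divisors, so the sum has absolute value sqrt q. *)

theory Submission
  imports Defs "HOL-Algebra.Multiplicative_Group" "HOL-Number_Theory.Cong"
begin

unbundle no fps_syntax

section \<open>Finite fields of characteristic 2\<close>

text \<open>The bilinear form must make sense at arguments such as the sum of two lifts, which is
  not a Teichmueller element. There the extension of the product by powers \<open>X ^ 2 ^ i\<close>
  fails to be additive, since squaring in \<open>R\<close> has the cross term
  \<open>2 * x * y\<close>. The remedy is to use iterates of the Frobenius automorphism in place of
  powers: the two agree on lifts, and the automorphism is additive on all of \<open>R\<close>. As
  \<open>R\<close> is known only through its reduction map, this automorphism is built from the two
  Teichmueller digits, and the trace is the sum of its iterates; additivity, invariance and the
  values in \<open>{0, 1, 2, 3}\<close> all come from this description. The symplectic condition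
  speaks of traces in the field, and an equality of traces modulo 2 says nothing modulo 4. It is
  therefore first converted into relations between coefficients, which rests on the uniqueness of
  expansions in linearized polynomials. The lift, the digits and the exponent of the root of unity
  are definite descriptions, so each has to be shown to be well posed.\<close>

lemma two_power_card_imp_pos:
  assumes "CARD('f::finite_field) = 2 ^ r"
  shows "0 < r"
proof (rule ccontr)
  assume "\<not> 0 < r"
  then have "CARD('f) = 1" using assms by simp
  then obtain z where "UNIV = {z :: 'f}" by (auto simp: card_1_singleton_iff)
  then have "(0::'f) = 1" by (metis UNIV_I singletonD)
  then show False by simp
qed

lemma two_eq_zero:
  assumes "CARD('f::finite_field) = 2 ^ r"
  shows "(2::'f) = 0"
proof -
  have "(-1::'f) ^ (2 ^ r) = -1"
    using finite_field_power_card_eq_same[of "-1::'f"] assms by simp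
  moreover have "(-1::'f) ^ (2 ^ r) = 1"
    using two_power_card_imp_pos[OF assms] by simp
  ultimately have "1 + 1 = (0::'f)" by (metis add.right_inverse)
  then show ?thesis by simp
qed

lemma add_self_eq_zero:
  assumes "CARD('f::finite_field) = 2 ^ r"
  shows "(x::'f) + x = 0"
  using two_eq_zero[OF assms] by (metis mult_2 mult_zero_left)

lemma uminus_eq_self:
  assumes "CARD('f::finite_field) = 2 ^ r"
  shows "- (x::'f) = x"
  using add_self_eq_zero[OF assms, of x] by (simp add: minus_unique)

lemma frobenius_add:
  assumes "CARD('f::finite_field) = 2 ^ r"
  shows "(x + y :: 'f) ^ 2 ^ k = x ^ 2 ^ k + y ^ 2 ^ k"
proof (induction k)
  case (Suc k)
  have "(x + y) ^ 2 ^ Suc k = ((x + y) ^ 2 ^ k)\<^sup>2"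
    by (simp add: power_mult mult.commute flip: power_mult)
  also have "\<dots> = (x ^ 2 ^ k)\<^sup>2 + (y ^ 2 ^ k)\<^sup>2"
    using Suc two_eq_zero[OF assms] by (simp add: power2_sum)
  finally show ?case by (simp add: mult.commute flip: power_mult)
qed simp

lemma power2_add:
  assumes "CARD('f::finite_field) = 2 ^ r"
  shows "(x + y :: 'f)\<^sup>2 = x\<^sup>2 + y\<^sup>2"
  using frobenius_add[OF assms, of x y 1] by simp

lemma frobenius_sum:
  assumes "CARD('f::finite_field) = 2 ^ r"
  shows "(\<Sum>i\<in>A. f i :: 'f) ^ 2 ^ k = (\<Sum>i\<in>A. f i ^ 2 ^ k)"
  by (induction A rule: infinite_finite_induct)
     (simp_all add: frobenius_add[OF assms] power_0_left)

lemma power_two_power_mod: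
  assumes "CARD('f::finite_field) = 2 ^ r"
  shows "(x::'f) ^ 2 ^ (k mod r) = x ^ 2 ^ k"
proof -
  have "x ^ 2 ^ k = (x ^ 2 ^ (k mod r)) ^ CARD('f) ^ (k div r)"
    by (simp add: assms flip: power_mult power_add)
  then show ?thesis by (simp add: finite_field_power_card_power_eq_same)
qed

text \<open>Cyclicity of the unit group is taken from the theory of fields given as records, so the
  type is wrapped in one. The generator is lifted later to exhibit the nonzero Teichmueller elements
  as the powers of a single unit.\<close>

lemma finite_field_generator:
  "\<exists>g::'f::finite_field. range (\<lambda>k::nat. g ^ k) = - {0}"
proof -
  define R where "R = \<lparr>carrier = UNIV :: 'f set, mult = (*) :: 'f \<Rightarrow> _, one = 1 :: 'f,
    zero = 0 :: 'f, add = (+)\<rparr>"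
  have R_simps [simp]: "carrier R = UNIV" "mult R = (*)" "one R = 1" "zero R = 0" "add R = (+)"
    by (simp_all add: R_def)
  have "cring R"
  proof (intro cringI abelian_groupI comm_monoidI)
    fix x show "\<exists>y\<in>carrier R. y \<oplus>\<^bsub>R\<^esub> x = \<zero>\<^bsub>R\<^esub>"
      by (auto intro: exI[of _ "- x"])
  qed (simp_all add: algebra_simps)
  moreover have "Units R = carrier R - {\<zero>\<^bsub>R\<^esub>}"
  proof -
    have "\<exists>y. y * x = 1 \<and> x * y = 1" if "x \<noteq> 0" for x :: 'f
      using that by (metis left_inverse right_inverse)
    then show ?thesis by (auto simp: Units_def)
  qed
  ultimately interpret field R
    by (rule cring.cring_fieldI)
  have pow: "x [^]\<^bsub>R\<^esub> n = x ^ n" for x :: 'f and n :: nat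
    by (induction n) (simp_all add: mult.commute)
  have "finite (carrier R)" by simp
  from finite_field_mult_group_has_gen[OF this]
  have "\<exists>g::'f. UNIV - {0} = {g ^ i | i::nat. i \<in> UNIV}"
    by (auto simp: pow)
  then obtain g :: 'f where "UNIV - {0} = {g ^ i | i::nat. i \<in> UNIV}" ..
  then show ?thesis by (intro exI[of _ g]) auto
qed

section \<open>Linearized polynomials\<close>

text \<open>The polynomial has degree at most \<open>2 ^ (r - 1)\<close>, half the size of the
  field, so it cannot vanish everywhere unless it is zero.\<close>

lemma linearized_coeffs_unique:
  fixes c :: "nat \<Rightarrow> 'f::finite_field"
  assumes card: "CARD('f) = 2 ^ r"
    and zero: "\<And>x. (\<Sum>i<r. c i * x ^ 2 ^ i) = 0" and "i < r"
  shows "c i = 0"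
proof -
  define p where "p = (\<Sum>i<r. Polynomial.monom (c i) (2 ^ i))"
  have "p = 0"
  proof (rule ccontr)
    assume "p \<noteq> 0"
    have "Polynomial.degree p \<le> 2 ^ (r - 1)"
      unfolding p_def
    proof (rule degree_sum_le)
      fix j assume "j \<in> {..<r}"
      then have "(2::nat) ^ j \<le> 2 ^ (r - 1)" by (intro power_increasing) auto
      then show "Polynomial.degree (Polynomial.monom (c j) (2 ^ j)) \<le> 2 ^ (r - 1)"
        using degree_monom_le order_trans by blast
    qed simp
    moreover have "{x. poly p x = 0} = UNIV"
      using zero by (simp add: p_def poly_sum poly_monom)
    then have "CARD('f) \<le> Polynomial.degree p"
      using card_poly_roots_bound[OF \<open>p \<noteq> 0\<close>] by simp
    moreover have "(2::nat) ^ (r - 1) < 2 ^ r"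
      using two_power_card_imp_pos[OF card] by simp
    ultimately show False using card by linarith
  qed
  then have "0 = Polynomial.coeff p (2 ^ i)" by simp
  also have "\<dots> = (\<Sum>j<r. if j = i then c j else 0)"
    unfolding p_def by (simp add: Polynomial.coeff_sum coeff_monom)
  also have "\<dots> = c i" using \<open>i < r\<close> by simp
  finally show ?thesis by simp
qed

text \<open>If \<open>l\<close> is the linearized polynomial vanishing exactly on \<open>V\<close> and \<open>e \<notin> V\<close>, then
  \<open>l x * l (x + e) = (l x)\<^sup>2 + l e * l x\<close> is the one vanishing exactly on the span of \<open>V\<close> and
  \<open>e\<close>, and adding a multiple of \<open>l\<close> to an interpolant on \<open>V\<close> adjusts its value at \<open>e\<close>.\<close>

lemma linearized_interpolation:
  assumes card: "CARD('f::finite_field) = 2 ^ r" and "k \<le> r"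
  shows "\<exists>V :: 'f set. \<exists>c. card V = 2 ^ k \<and> (\<forall>x. (\<Sum>i\<le>k. c i * x ^ 2 ^ i) = 0 \<longleftrightarrow> x \<in> V) \<and>
    (\<forall>f :: 'f \<Rightarrow> 'f. (\<forall>x y. f (x + y) = f x + f y) \<longrightarrow>
      (\<exists>d. \<forall>x\<in>V. f x = (\<Sum>i<k. d i * x ^ 2 ^ i)))"
  using \<open>k \<le> r\<close>
proof (induction k)
  case 0
  \<comment> \<open>For \<open>k = 0\<close> the interpolant is the empty sum, which is right
    because an additive map vanishes at 0.\<close>
  have "f 0 = 0" if "\<forall>x y. f (x + y) = f x + f y" for f :: "'f \<Rightarrow> 'f"
    using that by (metis add_cancel_right_right)
  then show ?case by (intro exI[of _ "{0}"] exI[of _ "\<lambda>_. 1"]) auto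
next
  case (Suc k)
  then obtain V :: "'f set" and c where cV: "card V = 2 ^ k"
    and c: "\<And>x. (\<Sum>i\<le>k. c i * x ^ 2 ^ i) = 0 \<longleftrightarrow> x \<in> V"
    and ex: "\<And>f :: 'f \<Rightarrow> 'f. (\<And>x y. f (x + y) = f x + f y) \<Longrightarrow>
      \<exists>d. \<forall>x\<in>V. f x = (\<Sum>i<k. d i * x ^ 2 ^ i)"
    by auto
  define l where "l x = (\<Sum>i\<le>k. c i * x ^ 2 ^ i)" for x
  \<comment> \<open>The induction does not record that \<open>V\<close> is a subgroup; this is
    recovered from its being the zero set of the additive map \<open>l\<close>.\<close>
  have l_add: "l (x + y) = l x + l y" for x y
    by (simp add: l_def frobenius_add[OF card] distrib_left sum.distrib)
  have l_V: "l x = 0 \<longleftrightarrow> x \<in> V" for x using c by (simp add: l_def)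
  have "V \<noteq> UNIV" using cV card Suc.prems by auto
  then obtain e where e: "e \<notin> V" by auto
  define W where "W = V \<union> (\<lambda>v. v + e) ` V"
  have mem_W: "x \<in> W \<longleftrightarrow> x \<in> V \<or> x + e \<in> V" for x
  proof -
    have "x + e + e = x" using add_self_eq_zero[OF card, of e] by (simp add: add.assoc)
    then show ?thesis
      unfolding W_def by (auto simp: add.assoc add_self_eq_zero[OF card] intro: rev_image_eqI)
  qed
  have "V \<inter> (\<lambda>v. v + e) ` V = {}"
    using e by (auto simp: l_add simp flip: l_V)
  then have "card W = 2 ^ Suc k"
    unfolding W_def by (simp add: card_Un_disjoint card_image cV)
  \<comment> \<open>These are the coefficients of \<open>(l x) ^ 2 + l e * l x\<close>: squaring
    \<open>l x\<close> squares each coefficient and shifts its index up by one, leaving index 0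
    empty.\<close>
  moreover define c' where "c' i = (if i = 0 then 0 else c (i - 1) ^ 2) + (if i \<le> k then l e * c i else 0)" for i
  have "(\<Sum>i\<le>Suc k. c' i * x ^ 2 ^ i) = 0 \<longleftrightarrow> x \<in> W" for x
  proof -
    have "(\<Sum>i\<le>Suc k. c' i * x ^ 2 ^ i)
        = (\<Sum>i\<le>Suc k. (if i = 0 then 0 else c (i - 1) ^ 2) * x ^ 2 ^ i)
          + (\<Sum>i\<le>Suc k. (if i \<le> k then l e * c i else 0) * x ^ 2 ^ i)"
      unfolding c'_def distrib_right by (rule sum.distrib)
    also have "(\<Sum>i\<le>Suc k. (if i = 0 then 0 else c (i - 1) ^ 2) * x ^ 2 ^ i)
        = (\<Sum>i\<le>k. (c i * x ^ 2 ^ i) ^ 2)"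
      by (subst sum.atMost_Suc_shift) (simp add: power_mult_distrib mult.commute flip: power_mult)
    also have "\<dots> = (l x) ^ 2"
      using frobenius_sum[OF card, of "\<lambda>i. c i * x ^ 2 ^ i" "{..k}" 1] by (simp add: l_def)
    also have "(\<Sum>i\<le>Suc k. (if i \<le> k then l e * c i else 0) * x ^ 2 ^ i) = l e * l x"
      by (simp add: l_def sum_distrib_left mult.assoc)
    also have "(l x)\<^sup>2 + l e * l x = l x * l (x + e)"
      by (simp add: l_add power2_eq_square algebra_simps)
    finally show ?thesis by (simp add: l_V mem_W)
  qed
  moreover have "\<exists>d. \<forall>x\<in>W. f x = (\<Sum>i<Suc k. d i * x ^ 2 ^ i)"
    if f: "\<And>x y. f (x + y) = f x + f y" for f :: "'f \<Rightarrow> 'f"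
  proof -
    obtain d where d: "\<And>x. x \<in> V \<Longrightarrow> f x = (\<Sum>i<k. d i * x ^ 2 ^ i)"
      using ex[OF f] by blast
    define p where "p x = (\<Sum>i<k. d i * x ^ 2 ^ i)" for x
    have p_add: "p (x + y) = p x + p y" for x y
      by (simp add: p_def frobenius_add[OF card] distrib_left sum.distrib)
    define t where "t = (f e - p e) / l e"
    define d' where "d' i = (if i < k then d i else 0) + t * c i" for i
    have eq: "(\<Sum>i<Suc k. d' i * x ^ 2 ^ i) = p x + t * l x" for x
      unfolding d'_def distrib_right sum.distrib
      by (simp add: p_def l_def sum_distrib_left mult.assoc distrib_left
          flip: lessThan_Suc_atMost)
    have V: "f x = p x + t * l x" if "x \<in> V" for x
      using that d l_V by (simp add: p_def)
    have E: "f e = p e + t * l e" using e l_V by (simp add: t_def)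
    have "f x = p x + t * l x" if "x \<in> W" for x
    proof (cases "x \<in> V")
      case False
      then have "x + e \<in> V" using that mem_W by simp
      then show ?thesis using V[of "x + e"] E
        by (simp add: f p_add l_add algebra_simps)
    qed (use V in simp)
    then show ?thesis using eq by metis
  qed
  ultimately show ?case by blast
qed

text \<open>At \<open>k = r\<close> the interpolation set has \<open>2 ^ r\<close> elements and is
  the whole field.\<close>

lemma additive_imp_linearized:
  fixes f :: "'f::finite_field \<Rightarrow> 'f"
  assumes card: "CARD('f) = 2 ^ r" and add: "\<And>x y. f (x + y) = f x + f y"
  shows "\<exists>d. \<forall>x. f x = (\<Sum>i<r. d i * x ^ 2 ^ i)"
proof -
  obtain V :: "'f set" where "card V = 2 ^ r"
    and V: "\<exists>d. \<forall>x\<in>V. f x = (\<Sum>i<r. d i * x ^ 2 ^ i)"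
    using linearized_interpolation[OF card order_refl] add by blast
  then have "V = UNIV" using card by (metis card_eq_UNIV_imp_eq_UNIV finite)
  then show ?thesis using V by auto
qed

section \<open>Expansions of biadditive maps\<close>

lemma expansion_coeffs_unique:
  assumes card: "CARD('f::finite_field) = 2 ^ r"
    and eq: "\<And>x y. (\<Sum>i<r. \<Sum>j<r. a i j * x ^ 2 ^ i * y ^ 2 ^ j)
      = (\<Sum>i<r. \<Sum>j<r. b i j * x ^ 2 ^ i * (y::'f) ^ 2 ^ j)"
    and "i < r" "j < r"
  shows "a i j = b i j"
proof -
  \<comment> \<open>For fixed \<open>y\<close> the difference is a linearized polynomial in
    \<open>x\<close> that vanishes everywhere; each of its coefficients is in turn a linearized
    polynomial in \<open>y\<close>.\<close>
  have "(\<Sum>j<r. (a i j - b i j) * y ^ 2 ^ j) = 0" for y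
  proof (rule linearized_coeffs_unique[OF card _ \<open>i < r\<close>])
    fix x
    have "(\<Sum>i<r. (\<Sum>j<r. (a i j - b i j) * y ^ 2 ^ j) * x ^ 2 ^ i)
      = (\<Sum>i<r. \<Sum>j<r. a i j * x ^ 2 ^ i * y ^ 2 ^ j) - (\<Sum>i<r. \<Sum>j<r. b i j * x ^ 2 ^ i * y ^ 2 ^ j)"
      by (simp add: sum_distrib_right sum_distrib_left left_diff_distrib
            right_diff_distrib sum_subtractf mult_ac)
    then show "(\<Sum>i<r. (\<Sum>j<r. (a i j - b i j) * y ^ 2 ^ j) * x ^ 2 ^ i) = 0"
      using eq by simp
  qed
  from linearized_coeffs_unique[OF card this \<open>j < r\<close>] show ?thesis by simp
qed

text \<open>Expanding in \<open>x\<close> for fixed \<open>y\<close> gives coefficients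
  \<open>d y i\<close>. They are unique, so additivity of the product in \<open>y\<close> passes to
  them, and they can be expanded as well.\<close>

lemma has_expansion_exists:
  fixes mul :: "'f::finite_field \<Rightarrow> 'f \<Rightarrow> 'f"
  assumes card: "CARD('f) = 2 ^ r" and "presemifield mul"
  shows "\<exists>a. has_expansion r mul a"
proof -
  have ml: "mul (x + y) z = mul x z + mul y z" and mr: "mul x (y + z) = mul x y + mul x z" for x y z
    using assms(2) by (simp_all add: presemifield_def)
  have "\<exists>d. \<forall>x. mul x y = (\<Sum>i<r. d i * x ^ 2 ^ i)" for y
    using additive_imp_linearized[OF card, of "\<lambda>x. mul x y"] ml by blast
  then obtain d where d: "\<And>x y. mul x y = (\<Sum>i<r. d y i * x ^ 2 ^ i)" by metis
  have d_add: "d (y + z) i = d y i + d z i" if "i < r" for y z i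
  proof -
    have "d (y + z) i - (d y i + d z i) = 0"
    proof (rule linearized_coeffs_unique[OF card _ that, where c = "\<lambda>i. d (y + z) i - (d y i + d z i)"])
      fix x
      show "(\<Sum>i<r. (d (y + z) i - (d y i + d z i)) * x ^ 2 ^ i) = 0"
        using mr[of x y z] by (simp add: d sum.distrib sum_subtractf algebra_simps)
    qed
    then show ?thesis by simp
  qed
  have "\<forall>i\<in>{..<r}. \<exists>b. \<forall>y. d y i = (\<Sum>j<r. b j * y ^ 2 ^ j)"
    using additive_imp_linearized[OF card, of "\<lambda>y. d y _"] d_add by simp
  then obtain b where b: "\<And>y i. i < r \<Longrightarrow> d y i = (\<Sum>j<r. b i j * y ^ 2 ^ j)"
    by (metis lessThan_iff)
  show ?thesis
    by (intro exI[of _ "\<lambda>i j. if i < r \<and> j < r then b i j else 0"])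
       (auto simp: has_expansion_def d b sum_distrib_left sum_distrib_right mult_ac intro!: sum.cong)
qed

lemma has_expansion_ex1:
  fixes mul :: "'f::finite_field \<Rightarrow> 'f \<Rightarrow> 'f"
  assumes card: "CARD('f) = 2 ^ r" and "presemifield mul"
  shows "\<exists>!a. has_expansion r mul a"
proof (rule ex_ex1I)
  fix a b assume ab: "has_expansion r mul a" "has_expansion r mul b"
  have "a i j = b i j" for i j
  proof (cases "i < r \<and> j < r")
    case True
    with ab expansion_coeffs_unique[OF card, of a b i j] show ?thesis
      by (simp add: has_expansion_def)
  next
    case False
    with ab show ?thesis by (auto simp: has_expansion_def)
  qed
  then show "a = b" by blast
qed (rule has_expansion_exists[OF assms])

section \<open>The absolute trace and adjoints\<close>

lemma abs_trace_add:
  assumes "CARD('f::finite_field) = 2 ^ r"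
  shows "abs_trace r (x + y :: 'f) = abs_trace r x + abs_trace r y"
  by (simp add: abs_trace_def frobenius_add[OF assms] sum.distrib)

lemma abs_trace_sum:
  assumes "CARD('f::finite_field) = 2 ^ r"
  shows "abs_trace r (\<Sum>i\<in>A. f i :: 'f) = (\<Sum>i\<in>A. abs_trace r (f i))"
  unfolding abs_trace_def by (subst frobenius_sum[OF assms]) (rule sum.swap)

lemma abs_trace_frobenius:
  assumes "CARD('f::finite_field) = 2 ^ r"
  shows "abs_trace r ((x::'f) ^ 2 ^ k) = abs_trace r x"
proof (induction k)
  case (Suc k)
  have step: "abs_trace r (y ^ 2) = abs_trace r y" for y :: 'f
  proof -
    \<comment> \<open>Squaring shifts the range of the sum by one; the added \<open>y\<close> fills
      index 0, and the new top term \<open>y ^ 2 ^ r\<close> is again \<open>y\<close>.\<close>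
    have "abs_trace r (y ^ 2) + y = (\<Sum>i<r. y ^ 2 ^ Suc i) + y ^ 2 ^ 0"
      by (simp add: abs_trace_def flip: power_mult)
    also have "\<dots> = (\<Sum>i<Suc r. y ^ 2 ^ i)"
      by (subst sum.lessThan_Suc_shift) simp
    also have "\<dots> = abs_trace r y + y"
      using finite_field_power_card_eq_same[of y] by (simp add: abs_trace_def assms)
    finally show ?thesis by simp
  qed
  have "x ^ 2 ^ Suc k = (x ^ 2 ^ k) ^ 2"
    by (simp add: mult.commute flip: power_mult)
  then show ?case using Suc step by simp
qed simp

text \<open>As a function of \<open>x\<close>, the trace of \<open>x * u\<close> is a linearized
  polynomial with coefficients \<open>u ^ 2 ^ i\<close>; the one at index 0 is
  \<open>u\<close>.\<close>

lemma abs_trace_nondegenerate: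
  assumes card: "CARD('f::finite_field) = 2 ^ r" and "\<And>x. abs_trace r (x * u) = 0"
  shows "(u::'f) = 0"
proof -
  have "(\<Sum>i<r. u ^ 2 ^ i * x ^ 2 ^ i) = 0" for x
    using assms(2)[of x] by (simp add: abs_trace_def power_mult_distrib mult.commute)
  from linearized_coeffs_unique[OF card this, of 0] show ?thesis
    using two_power_card_imp_pos[OF card] by simp
qed

text \<open>The index map \<open>(i, j) \<mapsto> (-i, j - i)\<close> modulo \<open>r\<close> describes taking adjoints of
  \<open>x \<mapsto> \<Sum> a\<^sub>i\<^sub>j x^(2^i) y^(2^j)\<close> with respect to the trace form; it is an involution.\<close>

lemma adjoint_index_involution:
  assumes "i < r" "j < (r::nat)"
  shows "(r - (r - i) mod r) mod r = i" "(r - (r - i) mod r + (r - i + j) mod r) mod r = j"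
  using assms by (cases "i = 0"; simp add: mod_simps)+

lemma sum_adjoint_index:
  "(\<Sum>i<r. \<Sum>j<r. G ((r - i) mod r) ((r - i + j) mod r)) = (\<Sum>i<r. \<Sum>j<(r::nat). G i j)"
  unfolding sum.cartesian_product
  by (rule sum.reindex_bij_witness
      [where i = "\<lambda>(i, j). ((r - i) mod r, (r - i + j) mod r)"
         and j = "\<lambda>(i, j). ((r - i) mod r, (r - i + j) mod r)"])
     (auto simp: adjoint_index_involution simp del: Nat.add_diff_assoc2)

text \<open>By \<open>sym\<close>, every map \<open>x \<mapsto> mul x y\<close> is its own adjoint
  for the trace form. Nondegeneracy turns this into an equality of maps, and uniqueness of the
  expansion into an equality of coefficients.\<close>

lemma symplectic_coeffs:
  fixes mul :: "'f::finite_field \<Rightarrow> 'f \<Rightarrow> 'f"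
  assumes card: "CARD('f) = 2 ^ r" and a: "has_expansion r mul a"
    and sym: "\<And>x y z. abs_trace r (x * mul y z) = abs_trace r (y * mul x z)"
    and ij: "i < r" "j < r"
  shows "a ((r - i) mod r) ((r - i + j) mod r) = a i j ^ 2 ^ (r - i)"
proof -
  \<comment> \<open>Coefficients of the adjoint: raising a term of index \<open>(i, j)\<close> to
    the power \<open>2 ^ (r - i)\<close> leaves its trace unchanged, frees \<open>z\<close> of its
    exponent and moves the term to index \<open>(-i, j - i)\<close>. The reduction modulo
    \<open>r\<close> sends the index \<open>r\<close>, which arises for \<open>i = 0\<close>, back
    to 0.\<close>
  define b where "b i j = a ((r - i) mod r) ((r - i + j) mod r) ^ 2 ^ i" for i j
  have mul: "mul x y = (\<Sum>i<r. \<Sum>j<r. a i j * x ^ 2 ^ i * y ^ 2 ^ j)" for x y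
    using a by (simp add: has_expansion_def)
  have b_adjoint: "b ((r - i) mod r) ((r - i + j) mod r) = a i j ^ 2 ^ (r - i)"
    if "i < r" "j < r" for i j
    using that by (simp add: b_def adjoint_index_involution power_two_power_mod[OF card]
        del: Nat.add_diff_assoc2)
  have mul_b: "mul x y = (\<Sum>i<r. \<Sum>j<r. b i j * x ^ 2 ^ i * y ^ 2 ^ j)" (is "_ = ?m x y") for x y
  proof -
    have "abs_trace r (z * mul x y) = abs_trace r (z * ?m x y)" for z
    proof -
      have frob: "abs_trace r (a i j * x * z ^ 2 ^ i * y ^ 2 ^ j)
          = abs_trace r (z * (b ((r - i) mod r) ((r - i + j) mod r)
              * x ^ 2 ^ ((r - i) mod r) * y ^ 2 ^ ((r - i + j) mod r)))"
        if "i < r" "j < r" for i j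
      proof -
        have z: "z ^ (2 ^ i * 2 ^ (r - i)) = z"
          using that finite_field_power_card_eq_same[of z]
          by (simp add: card flip: power_add)
        have "abs_trace r (a i j * x * z ^ 2 ^ i * y ^ 2 ^ j)
            = abs_trace r ((a i j * x * z ^ 2 ^ i * y ^ 2 ^ j) ^ 2 ^ (r - i))"
          by (rule abs_trace_frobenius[OF card, symmetric])
        also have "(a i j * x * z ^ 2 ^ i * y ^ 2 ^ j) ^ 2 ^ (r - i)
            = a i j ^ 2 ^ (r - i) * x ^ 2 ^ (r - i) * z * y ^ 2 ^ (r - i + j)"
          by (simp add: power_mult_distrib z power_add mult.commute flip: power_mult)
        finally show ?thesis
          using that
          by (simp add: b_adjoint power_two_power_mod[OF card] mult_ac del: Nat.add_diff_assoc2)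
      qed
      have "abs_trace r (z * mul x y) = abs_trace r (x * mul z y)" by (rule sym)
      also have "\<dots> = (\<Sum>i<r. \<Sum>j<r. abs_trace r (a i j * x * z ^ 2 ^ i * y ^ 2 ^ j))"
        by (simp add: mul sum_distrib_left abs_trace_sum[OF card] mult_ac)
      also have "\<dots> = (\<Sum>i<r. \<Sum>j<r. abs_trace r (z * (b i j * x ^ 2 ^ i * y ^ 2 ^ j)))"
        by (subst sum_adjoint_index[symmetric]) (simp add: frob)
      also have "\<dots> = abs_trace r (z * ?m x y)"
        by (simp add: sum_distrib_left abs_trace_sum[OF card])
      finally show ?thesis .
    qed
    moreover have "mul x y - ?m x y = mul x y + ?m x y"
      by (simp only: diff_conv_add_uminus uminus_eq_self[OF card])
    ultimately have "abs_trace r (z * (mul x y - ?m x y)) = 0" for z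
      by (simp only: distrib_left abs_trace_add[OF card] add_self_eq_zero[OF card])
    from abs_trace_nondegenerate[OF card this] show ?thesis by simp
  qed
  have "a i' j' = b i' j'" if "i' < r" "j' < r" for i' j'
    using expansion_coeffs_unique[OF card trans[OF mul[symmetric] mul_b] that] .
  moreover have "(r - i) mod r < r" "(r - i + j) mod r < r" using ij by simp_all
  ultimately show ?thesis using b_adjoint[OF ij] by metis
qed

section \<open>The Galois ring and its Teichmueller set\<close>

locale galois_ring =
  fixes r :: nat and red :: "'r::{comm_ring_1,finite} \<Rightarrow> 'f::finite_field"
  assumes card_field: "CARD('f) = 2 ^ r" and galois_ring_4: "galois_ring_4 r red"
begin

lemma red_1 [simp]: "red 1 = 1"
  and red_add [simp]: "red (x + y) = red x + red y"
  and red_mult [simp]: "red (x * y) = red x * red y"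
  and surj_red: "surj red"
  and card_ring: "CARD('r) = 4 ^ r"
  and CHAR_ring: "CHAR('r) = 4"
  using galois_ring_4 by (simp_all add: galois_ring_4_def)

lemma red_eq_0_iff_even: "red x = 0 \<longleftrightarrow> (\<exists>y. x = 2 * y)"
proof -
  have "{x. red x = 0} = range (\<lambda>x. 2 * x)"
    using galois_ring_4 by (simp add: galois_ring_4_def)
  then show ?thesis by auto
qed

lemma four_eq_0: "(4::'r) = 0"
  using of_nat_CHAR[where 'a = 'r] by (simp add: CHAR_ring)

lemma two_mult_two: "2 * (2 * x) = (0::'r)"
proof -
  have "2 * (2 * x) = 4 * x" by simp
  then show ?thesis by (simp only: four_eq_0 mult_zero_left)
qed

lemma red_0 [simp]: "red 0 = 0"
  using red_add[of 0 0] by (metis add.right_neutral add_left_cancel)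

lemma red_uminus [simp]: "red (- x) = - red x"
  using red_add[of x "- x"] by (simp add: eq_neg_iff_add_eq_0 add.commute del: red_add)

lemma red_diff [simp]: "red (x - y) = red x - red y"
  using red_add[of x "- y"] by (simp del: red_add)

lemma red_power [simp]: "red (x ^ n) = red x ^ n"
  by (induction n) simp_all

lemma red_sum [simp]: "red (sum f A) = (\<Sum>i\<in>A. red (f i))"
  by (induction A rule: infinite_finite_induct) simp_all

lemma red_of_nat [simp]: "red (of_nat n) = of_nat n"
  by (induction n) simp_all

lemma exponent_pos [simp]: "0 < r"
  using two_power_card_imp_pos[OF card_field] .

lemma card_red_fiber: "card {x. red x = u} = card {x. red x = 0}"
proof -
  obtain z where z: "red z = u" using surj_red by (metis surjD)
  have "bij_betw (\<lambda>x. x + z) {x. red x = 0} {x. red x = u}"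
    by (rule bij_betwI[where g = "\<lambda>x. x - z"]) (auto simp: z)
  then show ?thesis by (simp add: bij_betw_same_card)
qed

text \<open>Multiplication by 2 has image \<open>2R\<close> of size \<open>2 ^ r\<close>, hence a kernel of the same size, which
  contains \<open>2R\<close>.\<close>

lemma two_mult_eq_0_iff: "2 * x = 0 \<longleftrightarrow> red x = 0"
proof -
  have q2: "CARD('r) = 2 ^ r * 2 ^ r"
    by (simp add: card_ring flip: power_mult_distrib)
  define K where "K = {x. red x = 0}"
  define N where "N = {x::'r. 2 * x = 0}"
  have "CARD('r) = card (\<Union>u. {x. red x = u})"
    by (rule arg_cong[where f = card]) auto
  also have "\<dots> = (\<Sum>u\<in>UNIV. card {x. red x = u})"
    by (rule card_UN_disjoint) auto
  also have "\<dots> = (\<Sum>u\<in>(UNIV :: 'f set). card K)"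
    unfolding K_def by (rule sum.cong[OF refl card_red_fiber])
  also have "\<dots> = 2 ^ r * card K" by (simp add: card_field)
  finally have "card K = 2 ^ r" using q2 by simp
  have K: "K = range (\<lambda>x. 2 * x)" using red_eq_0_iff_even by (auto simp: K_def)
  have fib: "card {x::'r. 2 * x = 2 * z} = card N" for z
  proof -
    have "bij_betw (\<lambda>x. x + z) N {x. 2 * x = 2 * z}"
      by (rule bij_betwI[where g = "\<lambda>x. x - z"]) (auto simp: N_def algebra_simps)
    then show ?thesis by (simp add: bij_betw_same_card)
  qed
  have "CARD('r) = card (\<Union>u\<in>K. {x::'r. 2 * x = u})"
    by (rule arg_cong[where f = card]) (auto simp: K)
  also have "\<dots> = (\<Sum>u\<in>K. card {x::'r. 2 * x = u})"
    by (rule card_UN_disjoint) auto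
  also have "\<dots> = (\<Sum>u\<in>K. card N)"
    by (rule sum.cong) (auto simp: K fib)
  also have "\<dots> = 2 ^ r * card N" using \<open>card K = 2 ^ r\<close> by simp
  finally have "card N = 2 ^ r" using q2 by simp
  have "K \<subseteq> N" using two_mult_two by (auto simp: K N_def simp del: mult_numeral_left_semiring_numeral)
  then have "K = N" using \<open>card K = 2 ^ r\<close> \<open>card N = 2 ^ r\<close> by (simp add: card_subset_eq)
  then show ?thesis by (auto simp: K_def N_def)
qed

lemma red_2 [simp]: "red 2 = 0"
  using red_eq_0_iff_even[of 2] by (metis mult.right_neutral)

lemma two_mult_eq_iff: "2 * x = 2 * y \<longleftrightarrow> red x = red y"
  using two_mult_eq_0_iff[of "x - y"] by (simp add: right_diff_distrib)

lemma red_eqE: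
  assumes "red x = red y"
  obtains z where "x = y + 2 * z"
proof -
  have "red (x - y) = 0" using assms by simp
  then obtain z where "x - y = 2 * z" using red_eq_0_iff_even by blast
  then show thesis by (intro that[of z]) (simp add: algebra_simps)
qed

lemma power2_cong:
  assumes "red x = red y"
  shows "x\<^sup>2 = y\<^sup>2"
proof -
  obtain z where "x = y + 2 * z" using assms by (rule red_eqE)
  then have "x\<^sup>2 = y\<^sup>2 + 2 * (2 * (y * z)) + 2 * (2 * z\<^sup>2)"
    by (simp add: power2_sum power_mult_distrib algebra_simps)
  then show ?thesis by (simp add: two_mult_two del: mult_numeral_left_semiring_numeral)
qed

lemma power_two_power_cong:
  assumes "red x = red y" "0 < k"
  shows "x ^ 2 ^ k = y ^ 2 ^ k"
proof -
  have "x ^ 2 ^ k = (x\<^sup>2) ^ 2 ^ (k - 1)" for x :: 'r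
    using \<open>0 < k\<close> by (simp flip: power_mult power_Suc)
  then show ?thesis using power2_cong[OF assms(1)] by metis
qed

text \<open>The power \<open>x ^ q\<close> depends only on \<open>red x\<close>, because squaring already identifies elements
  congruent modulo 2.\<close>

definition teich :: "'f \<Rightarrow> 'r" where
  "teich u = (SOME x. red x = u) ^ 2 ^ r"

lemma teich_red: "teich (red x) = x ^ 2 ^ r"
  unfolding teich_def by (rule power_two_power_cong) (auto intro: someI)

lemma red_teich [simp]: "red (teich u) = u"
proof -
  obtain x where "red x = u" using surj_red by (metis surjD)
  then show ?thesis
    using teich_red[of x] finite_field_power_card_eq_same[of u] by (simp add: card_field)
qed

lemma teich_eq_iff [simp]: "teich u = teich v \<longleftrightarrow> u = v"
  by (metis red_teich)

lemma teich_mult: "teich (u * v) = teich u * teich v"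
proof -
  obtain x y where "red x = u" "red y = v" using surj_red by (metis surjD)
  then have "teich (u * v) = (x * y) ^ 2 ^ r" "teich u = x ^ 2 ^ r" "teich v = y ^ 2 ^ r"
    using teich_red by (metis red_mult)+
  then show ?thesis by (simp add: power_mult_distrib)
qed

lemma teich_0 [simp]: "teich 0 = 0"
  using teich_red[of 0] by (simp add: power_0_left)

lemma teich_1 [simp]: "teich 1 = 1"
  using teich_red[of 1] by simp

lemma teich_power: "teich (u ^ n) = teich u ^ n"
  by (induction n) (simp_all add: teich_mult)

text \<open>The case \<open>k = 0\<close> is the binomial formula. Each further squaring discards
  the old correction \<open>2 * c\<close>, by \<open>power2_cong\<close>, and creates one new cross
  term, so a single correction survives.\<close>

lemma power_add_two_power:
  "(x + y) ^ 2 ^ Suc k = x ^ 2 ^ Suc k + y ^ 2 ^ Suc k + 2 * (x * y :: 'r) ^ 2 ^ k"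
proof (induction k)
  case 0
  show ?case by (simp add: power2_sum)
next
  case (Suc k)
  define a b c where "a = x ^ 2 ^ Suc k" and "b = y ^ 2 ^ Suc k" and "c = (x * y) ^ 2 ^ k"
  have "(x + y) ^ 2 ^ Suc (Suc k) = (a + b + 2 * c)\<^sup>2"
    by (simp only: power_Suc2[of 2 "Suc k"] power_mult Suc a_def b_def c_def)
  also have "\<dots> = (a + b)\<^sup>2" by (rule power2_cong) simp
  also have "\<dots> = a\<^sup>2 + b\<^sup>2 + 2 * (a * b)" by (simp add: power2_sum)
  finally show ?case
    by (simp add: a_def b_def power_mult_distrib mult.commute flip: power_mult)
qed

text \<open>A lift equals its own power with exponent \<open>2 ^ r\<close>, so the lift of a sum is
  that power of the sum of the lifts. Exponent \<open>2 ^ (r - 1)\<close> inverts squaring on the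
  field: the correction is twice the lift of the square root of \<open>u * v\<close>.\<close>

lemma teich_add: "teich (u + v) = teich u + teich v + 2 * teich ((u * v) ^ 2 ^ (r - 1))"
proof -
  have fixed: "teich u ^ 2 ^ r = teich u" for u
    by (simp add: teich_red[symmetric])
  have "teich (u + v) = (teich u + teich v) ^ 2 ^ r"
    by (simp add: teich_red[symmetric])
  also have "\<dots> = teich u ^ 2 ^ r + teich v ^ 2 ^ r + 2 * (teich u * teich v) ^ 2 ^ (r - 1)"
    using power_add_two_power[of "teich u" "teich v" "r - 1"] by simp
  finally show ?thesis by (simp add: fixed teich_power teich_mult)
qed

section \<open>Units and the Teichmueller group\<close>

lemma is_unit_iff: "x dvd 1 \<longleftrightarrow> red x \<noteq> 0"
proof
  assume "x dvd 1"
  then obtain y where "1 = x * y" by (rule dvdE)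
  then have "1 = red x * red y" by (metis red_1 red_mult)
  then show "red x \<noteq> 0" by auto
next
  assume nz: "red x \<noteq> 0"
  \<comment> \<open>The product \<open>x * y\<close> is 1 only modulo 2. Its square is 1 in
    \<open>R\<close>, which makes \<open>x * y ^ 2\<close> an inverse of \<open>x\<close>.\<close>
  obtain y where "red y = inverse (red x)" using surj_red by (metis surjD)
  then have "red (x * y) = red 1" using nz by simp
  then have "(x * y)\<^sup>2 = 1" using power2_cong by fastforce
  then have "x * (x * y\<^sup>2) = 1" by (simp add: power2_eq_square mult_ac)
  then show "x dvd 1" by (metis dvdI)
qed

text \<open>Lagrange's argument: multiplication by \<open>g\<close> permutes the set of powers, so
  the product of all of them is unchanged by the factor \<open>g ^ n\<close>. That product is itself
  a power of \<open>g\<close> and can be cancelled.\<close>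

lemma unit_power_card_order:
  assumes "g dvd (1::'r)" and "card (range (\<lambda>k::nat. g ^ k)) = n"
  shows "g ^ n = 1"
proof -
  obtain h where h: "g * h = 1" using assms(1) by (metis dvdE)
  have cancel: "x = y" if "g ^ k * x = g ^ k * y" for x y k
  proof -
    have "h ^ k * g ^ k = 1" by (metis h mult.commute power_mult_distrib power_one)
    then show ?thesis using that by (metis mult.assoc mult_1)
  qed
  define C where "C = range (\<lambda>k::nat. g ^ k)"
  have "inj ((*) g)" using cancel[of 1] by (auto intro: injI)
  then have "(\<lambda>x. g * x) ` C = C"
    by (intro card_subset_eq card_image) (auto simp: C_def simp flip: power_Suc intro: inj_on_subset)
  then have "\<Prod>C = (\<Prod>x\<in>C. g * x)"
    using \<open>inj ((*) g)\<close> by (metis inj_on_subset prod.reindex_cong subset_UNIV)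
  also have "\<dots> = g ^ n * \<Prod>C"
    using assms(2) by (simp add: prod.distrib C_def)
  finally have "\<Prod>C = g ^ n * \<Prod>C" .
  moreover have "\<exists>k. \<Prod>D = g ^ k" if "finite D" "D \<subseteq> C" for D
    using that
  proof (induction D)
    case empty
    show ?case by (intro exI[of _ 0]) simp
  next
    case (insert x D)
    then obtain i j where "x = g ^ i" "\<Prod>D = g ^ j" by (auto simp: C_def)
    then show ?case using insert.hyps by (intro exI[of _ "i + j"]) (simp add: power_add)
  qed
  then obtain k where "\<Prod>C = g ^ k" by (metis finite subset_refl)
  ultimately have "g ^ k * g ^ n = g ^ k * 1" by (simp add: mult.commute)
  then show ?thesis by (rule cancel)
qed

text \<open>A generator of any candidate group satisfies \<open>g ^ 2 ^ r = g\<close> and is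
  therefore the lift of its own reduction. So the candidate lies inside the set of nonzero lifts,
  and equal cardinalities finish.\<close>

lemma teichmueller_group_eq: "teichmueller_group r = teich ` (- {0})"
  unfolding teichmueller_group_def
proof (rule the_equality)
  have card: "card (teich ` (- {0})) = 2 ^ r - 1"
    by (subst card_image) (auto simp: inj_on_def card_field card_Diff_singleton Compl_eq_Diff_UNIV)
  obtain g :: 'f where g: "range (\<lambda>k::nat. g ^ k) = - {0}"
    using finite_field_generator by blast
  then have "g \<noteq> 0" by (metis Compl_iff power_one_right rangeI singletonI)
  then have "teich g dvd 1" by (simp add: is_unit_iff)
  moreover have "teich ` (- {0}) = range (\<lambda>k::nat. teich g ^ k)"
    by (simp only: g[symmetric] image_image teich_power)
  ultimately show "(\<exists>g. g dvd 1 \<and> teich ` (- {0}) = range (\<lambda>k::nat. g ^ k)) \<and>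
      card (teich ` (- {0})) = 2 ^ r - 1"
    using card by blast
  fix C :: "'r set"
  assume C: "(\<exists>g. g dvd 1 \<and> C = range (\<lambda>k::nat. g ^ k)) \<and> card C = 2 ^ r - 1"
  then obtain g where g: "g dvd 1" and C_eq: "C = range (\<lambda>k::nat. g ^ k)" by blast
  have "g ^ (2 ^ r - 1) = 1" using unit_power_card_order[OF g] C C_eq by simp
  then have "g ^ 2 ^ r = g"
    by (metis One_nat_def Suc_pred mult.right_neutral pos2 power_Suc zero_less_power)
  then have "g = teich (red g)" by (simp add: teich_red)
  then have "g ^ k = teich (red g ^ k)" for k by (metis teich_power)
  moreover have "red g ^ k \<in> - {0}" for k using g by (simp add: is_unit_iff)
  ultimately have "C \<subseteq> teich ` (- {0})"
    unfolding C_eq by (metis image_eqI image_subsetI)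
  then show "C = teich ` (- {0})" using C card by (simp add: card_subset_eq)
qed

lemma teichmueller_set_eq: "teichmueller_set r = range teich"
proof -
  have "range teich = teich ` insert 0 (- {0})" by (rule arg_cong[where f = "(`) teich"]) auto
  then show ?thesis unfolding teichmueller_set_def teichmueller_group_eq by simp
qed

lemma teichmueller_lift_eq: "teichmueller_lift r red = teich"
  unfolding teichmueller_lift_def teichmueller_set_eq by (intro ext the_equality) auto

section \<open>Teichmueller digits and the Frobenius map\<close>

lemma teich_decomposition:
  obtains u v where "x = teich u + 2 * teich v"
proof -
  obtain y where "x = teich (red x) + 2 * y" by (rule red_eqE[of x "teich (red x)"]) auto
  moreover have "2 * y = 2 * teich (red y)" by (simp add: two_mult_eq_iff)
  ultimately show thesis using that by metis
qed

lemma teich_decomposition_unique: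
  "teich u + 2 * teich v = teich u' + 2 * teich v' \<longleftrightarrow> u = u' \<and> v = v'"
proof
  assume eq: "teich u + 2 * teich v = teich u' + 2 * teich v'"
  have "red (teich u + 2 * teich v) = u" for u v
    using two_mult_eq_0_iff[of "2 * teich v"] two_mult_two by simp
  then have "u = u'" using eq by metis
  moreover from this have "v = v'" using eq by (simp add: two_mult_eq_iff)
  ultimately show "u = u' \<and> v = v'" by simp
qed simp

lemma teichmueller_parts_eq: "teichmueller_parts r (teich u + 2 * teich v) = (teich u, teich v)"
  unfolding teichmueller_parts_def teichmueller_set_eq
  by (rule the_equality) (auto simp: teich_decomposition_unique)

text \<open>The automorphism of \<open>R\<close> that induces squaring on the residue field.\<close>

definition frob :: "'r \<Rightarrow> 'r" where
  "frob x = (case teichmueller_parts r x of (a, b) \<Rightarrow> a\<^sup>2 + 2 * b\<^sup>2)"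

lemma frob_parts: "frob (teich u + 2 * teich v) = teich (u\<^sup>2) + 2 * teich (v\<^sup>2)"
  by (simp add: frob_def teichmueller_parts_eq teich_power)

text \<open>Twice an element depends only on its reduction, so the second digit may be replaced by
  any \<open>y\<close>. Sums and products of digits then need no normalisation.\<close>

lemma frob_eq: "frob (teich u + 2 * y) = teich u ^ 2 + 2 * y\<^sup>2"
proof -
  have "2 * y = 2 * teich (red y)" "2 * y\<^sup>2 = 2 * teich ((red y)\<^sup>2)"
    by (simp_all add: two_mult_eq_iff)
  then show ?thesis by (simp add: frob_parts teich_power)
qed

text \<open>Adding the first digits produces the carry \<open>t\<close>, the lift of the square root
  of \<open>u * v\<close>. After \<open>frob\<close> the carry contributes \<open>2 * t ^ 2\<close>,
  and the square of the sum of the lifts has the cross term \<open>2 * teich u * teich v\<close>.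
  The two are equal, so together they vanish modulo 4.\<close>

lemma frob_add: "frob (x + y) = frob x + frob y"
proof -
  obtain u b where x: "x = teich u + 2 * b" by (metis teich_decomposition)
  obtain v c where y: "y = teich v + 2 * c" by (metis teich_decomposition)
  have frob_xy: "frob x = (teich u)\<^sup>2 + 2 * b\<^sup>2" "frob y = (teich v)\<^sup>2 + 2 * c\<^sup>2"
    by (simp_all only: x y frob_eq)
  define t where "t = teich ((u * v) ^ 2 ^ (r - 1))"
  have "t\<^sup>2 = teich ((u * v) ^ 2 ^ r)"
    by (simp add: t_def flip: teich_power power_mult power_Suc2)
  also have "\<dots> = teich u * teich v"
    using finite_field_power_card_eq_same[of "u * v"] by (simp add: card_field teich_mult)
  finally have t2: "t\<^sup>2 = teich u * teich v" .
  have "2 * (2 * t) = 0" by (rule two_mult_two)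
  then have "x + y = teich (u + v) + 2 * (b + c + t)"
    unfolding x y teich_add by (simp add: t_def algebra_simps)
  then have "frob (x + y) = teich (u + v) ^ 2 + 2 * (b + c + t)\<^sup>2"
    by (simp only: frob_eq)
  also have "\<dots> = (teich u + teich v)\<^sup>2 + 2 * (b + c + t)\<^sup>2"
    using power2_cong[of "teich (u + v)" "teich u + teich v"] by simp
  also have "\<dots> = (teich u + teich v)\<^sup>2 + 2 * (b\<^sup>2 + c\<^sup>2 + t\<^sup>2)"
    by (simp only: add_left_cancel two_mult_eq_iff red_power red_add power2_add[OF card_field])
  also have "\<dots> = frob x + frob y + 2 * (2 * t\<^sup>2)"
    by (simp add: frob_xy power2_sum t2 algebra_simps)
  finally show ?thesis by (simp only: two_mult_two add_0_right)
qed

lemma frob_mult: "frob (x * y) = frob x * frob y"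
proof -
  obtain u b where x: "x = teich u + 2 * b" by (metis teich_decomposition)
  obtain v c where y: "y = teich v + 2 * c" by (metis teich_decomposition)
  have frob_xy: "frob x = (teich u)\<^sup>2 + 2 * b\<^sup>2" "frob y = (teich v)\<^sup>2 + 2 * c\<^sup>2"
    by (simp_all only: x y frob_eq)
  have "x * y = teich (u * v) + 2 * (teich u * c + teich v * b) + 2 * (2 * (b * c))"
    by (simp add: x y teich_mult algebra_simps)
  then have "frob (x * y) = teich (u * v) ^ 2 + 2 * (teich u * c + teich v * b)\<^sup>2"
    by (simp only: two_mult_two add_0_right frob_eq)
  also have "\<dots> = teich (u * v) ^ 2 + 2 * ((teich u * c)\<^sup>2 + (teich v * b)\<^sup>2)"
    by (simp only: add_left_cancel two_mult_eq_iff red_power red_add power2_add[OF card_field])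
  also have "\<dots> = frob x * frob y - 2 * (2 * (b\<^sup>2 * c\<^sup>2))"
    by (simp add: frob_xy teich_mult power_mult_distrib algebra_simps)
  finally show ?thesis by (simp only: two_mult_two diff_0_right)
qed

end

section \<open>Frobenius and trace of the Galois ring\<close>

context galois_ring
begin

lemma frob_pow_add: "(frob ^^ k) (x + y) = (frob ^^ k) x + (frob ^^ k) y"
  by (induction k) (simp_all add: frob_add)

lemma frob_pow_mult: "(frob ^^ k) (x * y) = (frob ^^ k) x * (frob ^^ k) y"
  by (induction k) (simp_all add: frob_mult)

lemma frob_pow_parts:
  "(frob ^^ k) (teich u + 2 * teich v) = teich (u ^ 2 ^ k) + 2 * teich (v ^ 2 ^ k)"
proof (induction k)
  case (Suc k)
  then show ?case by (simp add: frob_parts mult.commute flip: power_mult)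
qed simp

lemma frob_pow_teich: "(frob ^^ k) (teich u) = teich (u ^ 2 ^ k)"
  using frob_pow_parts[of k u 0] by (simp add: power_0_left)

lemma frob_pow_0 [simp]: "(frob ^^ k) 0 = 0"
  using frob_pow_teich[of k 0] by (simp add: power_0_left)

lemma frob_pow_period: "(frob ^^ r) x = x"
proof -
  obtain u v where "x = teich u + 2 * teich v" by (rule teich_decomposition)
  then show ?thesis
    using finite_field_power_card_eq_same[of u] finite_field_power_card_eq_same[of v]
    by (simp add: frob_pow_parts card_field)
qed

lemma frob_pow_mod: "(frob ^^ (k mod r)) x = (frob ^^ k) x"
  by (rule funpow_mod_eq) (rule frob_pow_period)

lemma red_frob_pow [simp]: "red ((frob ^^ k) x) = red x ^ 2 ^ k"
proof -
  obtain u v where "x = teich u + 2 * teich v" by (rule teich_decomposition)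
  then show ?thesis by (simp add: frob_pow_parts)
qed

lemma galois_trace_eq: "galois_trace r x = (\<Sum>i<r. (frob ^^ i) x)"
proof -
  obtain u v where "x = teich u + 2 * teich v" by (rule teich_decomposition)
  then show ?thesis
    by (simp add: galois_trace_def teichmueller_parts_eq frob_pow_parts teich_power)
qed

lemma galois_trace_add: "galois_trace r (x + y :: 'r) = galois_trace r x + galois_trace r y"
  by (simp add: galois_trace_eq frob_pow_add sum.distrib)

lemma galois_trace_0 [simp]: "galois_trace r (0::'r) = 0"
  by (simp add: galois_trace_eq)

lemma galois_trace_sum: "galois_trace r (\<Sum>i\<in>A. f i :: 'r) = (\<Sum>i\<in>A. galois_trace r (f i))"
  by (induction A rule: infinite_finite_induct) (simp_all add: galois_trace_add)

lemma red_galois_trace: "red (galois_trace r x) = abs_trace r (red x)"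
  by (simp add: galois_trace_eq abs_trace_def)

lemma galois_trace_frob: "galois_trace r (frob x) = galois_trace r x"
proof -
  have "galois_trace r (frob x) + x = (\<Sum>i<r. (frob ^^ Suc i) x) + (frob ^^ 0) x"
    by (simp add: galois_trace_eq funpow_swap1)
  also have "\<dots> = (\<Sum>i<Suc r. (frob ^^ i) x)"
    by (subst sum.lessThan_Suc_shift) simp
  also have "\<dots> = galois_trace r x + x"
    by (simp add: galois_trace_eq frob_pow_period)
  finally show ?thesis by simp
qed

lemma galois_trace_frob_pow: "galois_trace r ((frob ^^ k) x) = galois_trace r x"
  by (induction k) (simp_all add: galois_trace_frob)

lemma frob_galois_trace: "frob (galois_trace r x) = galois_trace r x"
proof -
  have "frob (sum f A) = (\<Sum>i\<in>A. frob (f i))" for f :: "nat \<Rightarrow> 'r" and A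
    using frob_pow_0[of 1] by (induction A rule: infinite_finite_induct) (simp_all add: frob_add)
  then have "frob (galois_trace r x) = galois_trace r (frob x)"
    by (simp add: galois_trace_eq funpow_swap1)
  then show ?thesis by (simp add: galois_trace_frob)
qed

text \<open>The trace is fixed by \<open>frob\<close>, so both of its digits are fixed by squaring
  and lie in \<open>{0, 1}\<close>. This guarantees that the exponent described in
  \<open>z4_pow\<close> exists.\<close>

lemma galois_trace_of_nat: "\<exists>k. galois_trace r x = (of_nat k :: 'r)"
proof -
  obtain u v where uv: "galois_trace r x = teich u + 2 * teich v"
    by (rule teich_decomposition)
  then have "u\<^sup>2 = u \<and> v\<^sup>2 = v"
    using frob_galois_trace[of x] frob_parts[of u v] by (metis teich_decomposition_unique)
  then have "u \<in> {0, 1}" "v \<in> {0, 1}" by (auto simp: power2_eq_square)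
  then have "teich u = of_nat (if u = 0 then 0 else 1)" "teich v = of_nat (if v = 0 then 0 else 1)"
    by auto
  then show ?thesis unfolding uv by (metis of_nat_add of_nat_mult of_nat_numeral)
qed

end

section \<open>Additive characters\<close>

lemma mult_cnj_eq_1: "cmod z = 1 \<Longrightarrow> z * cnj z = 1"
  using complex_norm_square[of z] by simp

locale galois_ring_character = galois_ring r red
  for r :: nat and red :: "'r::{comm_ring_1,finite} \<Rightarrow> 'f::finite_field" +
  fixes \<omega> :: complex
  assumes root: "primitive_4th_root \<omega>"
begin

lemma root_4: "\<omega> ^ 4 = 1" and root_2: "\<omega> ^ 2 \<noteq> 1"
  using root by (simp_all add: primitive_4th_root_def)

lemma root_mod: "\<omega> ^ (k mod 4) = \<omega> ^ k"
proof -
  have "\<omega> ^ k = \<omega> ^ (k mod 4 + 4 * (k div 4))" by simp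
  also have "\<dots> = \<omega> ^ (k mod 4)" unfolding power_add power_mult root_4 by simp
  finally show ?thesis ..
qed

lemma z4_pow_of_nat: "z4_pow \<omega> (of_nat k :: 'r) = \<omega> ^ k"
proof -
  have "(THE j::nat. j < 4 \<and> of_nat j = (of_nat k :: 'r)) = k mod 4"
    by (rule the_equality) (auto simp: of_nat_eq_iff_cong_CHAR CHAR_ring cong_def)
  then show ?thesis by (simp add: z4_pow_def root_mod)
qed

definition char4 :: "'r \<Rightarrow> complex" where
  "char4 x = z4_pow \<omega> (galois_trace r x)"

text \<open>This is the sign \<open>(-1)\<close> raised to the absolute trace of
  \<open>u\<close>.\<close>

definition char2 :: "'f \<Rightarrow> complex" where
  "char2 u = char4 (2 * teich u)"

lemma char4_add: "char4 (x + y) = char4 x * char4 y"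
proof -
  obtain k l where "galois_trace r x = (of_nat k :: 'r)" "galois_trace r y = (of_nat l :: 'r)"
    using galois_trace_of_nat by metis
  then show ?thesis
    using z4_pow_of_nat[of "k + l"]
    by (simp add: char4_def galois_trace_add z4_pow_of_nat power_add)
qed

lemma char4_0 [simp]: "char4 0 = 1"
  using z4_pow_of_nat[of 0] by (simp add: char4_def)

lemma char4_power_4: "char4 x ^ 4 = 1"
proof -
  obtain k where "galois_trace r x = (of_nat k :: 'r)" using galois_trace_of_nat by blast
  then have "char4 x ^ 4 = (\<omega> ^ 4) ^ k"
    by (simp add: char4_def z4_pow_of_nat mult.commute flip: power_mult)
  then show ?thesis by (simp add: root_4)
qed

lemma norm_char4 [simp]: "cmod (char4 x) = 1"
proof -
  have "cmod (char4 x) ^ 4 = 1 ^ 4" by (simp add: char4_power_4 flip: norm_power)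
  then show ?thesis by (rule power_eq_imp_eq_base) simp_all
qed

lemma char4_double: "char4 (2 * x) = char4 x ^ 2"
  by (simp only: mult_2 char4_add power2_eq_square)

lemma char4_double_eq_char2: "char4 (2 * x) = char2 (red x)"
proof -
  have "2 * x = 2 * teich (red x)" by (simp add: two_mult_eq_iff)
  then show ?thesis by (simp add: char2_def)
qed

lemma norm_char2 [simp]: "cmod (char2 u) = 1"
  by (simp add: char2_def)

lemma char2_add: "char2 (u + v) = char2 u * char2 v"
proof -
  have "char2 (u + v) = char4 (2 * (teich u + teich v))"
    by (simp only: char4_double_eq_char2 red_add red_teich)
  then show ?thesis by (simp add: char2_def distrib_left char4_add)
qed

lemma char2_0 [simp]: "char2 0 = 1"
  by (simp add: char2_def)

text \<open>Since \<open>u + u = 0\<close>, every value squares to 1, and so does not differ from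
  its inverse, which is its conjugate.\<close>

lemma cnj_char2 [simp]: "cnj (char2 u) = char2 u"
proof -
  have "char2 u * char2 u = 1"
    using char2_add[of u u] by (simp add: add_self_eq_zero[OF card_field])
  moreover have "char2 u * cnj (char2 u) = 1" by (rule mult_cnj_eq_1) simp
  ultimately have "char2 u * cnj (char2 u) = char2 u * char2 u" by simp
  moreover have "char2 u \<noteq> 0" by (metis norm_char2 norm_zero zero_neq_one)
  ultimately show ?thesis by simp
qed

lemma char2_neq_1:
  assumes "abs_trace r u \<noteq> 0"
  shows "char2 u \<noteq> 1"
proof -
  obtain k where k: "galois_trace r (teich u) = (of_nat k :: 'r)"
    using galois_trace_of_nat by blast
  then have "of_nat k \<noteq> (0::'f)"
    using assms red_galois_trace[of "teich u"] by simp
  then have "odd k"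
    using two_eq_zero[OF card_field] by (metis evenE mult_zero_left of_nat_mult of_nat_numeral)
  then obtain j where j: "k = 2 * j + 1" by (rule oddE)
  \<comment> \<open>For odd \<open>k\<close> the exponent \<open>2 * k\<close> is 2 modulo 4, so the
    value is \<open>\<omega> ^ 2\<close>.\<close>
  have "char2 u = (\<omega> ^ k) ^ 2" 
    by (simp only: char2_def char4_double) (simp add: char4_def k z4_pow_of_nat)
  also have "\<dots> = (\<omega> ^ 4) ^ j * \<omega> ^ 2"
    by (simp only: j power_mult[symmetric] power_add[symmetric])
       (rule arg_cong[where f = "power \<omega>"], simp)
  finally show ?thesis by (simp add: root_4 root_2)
qed

lemma sum_char2: "(\<Sum>u\<in>UNIV. char2 (u * v)) = (if v = 0 then of_nat CARD('f) else 0)"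
proof (cases "v = 0")
  case False
  then obtain z where "abs_trace r (z * v) \<noteq> 0"
    using abs_trace_nondegenerate[OF card_field] by blast
  then have z: "char2 (z * v) \<noteq> 1" by (rule char2_neq_1)
  \<comment> \<open>Translation by \<open>z\<close> permutes the summands and multiplies the sum by
    a factor different from 1.\<close>
  have "(\<Sum>u\<in>UNIV. char2 (u * v)) = (\<Sum>u\<in>UNIV. char2 ((u + z) * v))"
    by (rule sum.reindex_bij_witness[where i = "\<lambda>u. u + z" and j = "\<lambda>u. u - z"]) auto
  also have "\<dots> = (\<Sum>u\<in>UNIV. char2 (u * v)) * char2 (z * v)"
    by (simp only: distrib_right char2_add sum_distrib_right)
  finally show ?thesis using z False by (simp add: mult_cancel_left1)
qed simp

text \<open>Evaluation of a Gauss sum: in the squared modulus, the substitution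
  \<open>v = w + u\<close> cancels the values at \<open>w\<close> and leaves
  \<open>g u * char2 (u * L w)\<close>. As \<open>L\<close> permutes the field, summing over
  \<open>w\<close> kills every \<open>u\<close> except 0, where \<open>g 0 = 1\<close>.\<close>

lemma norm_quadratic_sum:
  assumes norm: "\<And>w. cmod (g w) = 1"
    and add: "\<And>w u. g (w + u) = g w * g u * char2 (u * L w)" and L: "bij L"
  shows "(cmod (\<Sum>w\<in>UNIV. g w))\<^sup>2 = real CARD('f)"
proof -
  have "g 0 \<noteq> 0" by (metis norm norm_zero zero_neq_one)
  moreover have "g 0 = g 0 * g 0" using add[of 0 0] by (simp only: add_0 mult_zero_left char2_0 mult_1_right)
  ultimately have "g 0 = 1" by (metis mult_cancel_left mult_1_right)
  have sum_char2': "(\<Sum>z\<in>UNIV. char2 (u * z)) = (if u = 0 then of_nat CARD('f) else 0)" for u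
    using sum_char2[of u] by (simp only: mult.commute[of u])
  have inner: "(\<Sum>v\<in>UNIV. g v * cnj (g w)) = (\<Sum>u\<in>UNIV. g u * char2 (u * L w))" for w
  proof -
    have "g w * cnj (g w) = 1" by (rule mult_cnj_eq_1) (rule norm)
    moreover have "g (w + u) * cnj (g w) = (g w * cnj (g w)) * (g u * char2 (u * L w))" for u
      by (simp only: add mult_ac)
    ultimately have *: "g (w + u) * cnj (g w) = g u * char2 (u * L w)" for u
      by (simp only: mult_1)
    have "(\<Sum>v\<in>UNIV. g v * cnj (g w)) = (\<Sum>u\<in>UNIV. g (w + u) * cnj (g w))"
      by (rule sum.reindex_bij_witness[where i = "\<lambda>u. w + u" and j = "\<lambda>u. u - w"]) auto
    then show ?thesis by (simp add: *)
  qed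
  have "complex_of_real ((cmod (\<Sum>w\<in>UNIV. g w))\<^sup>2) = (\<Sum>w\<in>UNIV. g w) * cnj (\<Sum>w\<in>UNIV. g w)"
    by (simp only: complex_norm_square)
  also have "\<dots> = (\<Sum>w\<in>UNIV. \<Sum>v\<in>UNIV. g v * cnj (g w))"
    by (simp add: sum_product) (rule sum.swap)
  also have "\<dots> = (\<Sum>w\<in>UNIV. \<Sum>u\<in>UNIV. g u * char2 (u * L w))"
    by (simp only: inner)
  also have "\<dots> = (\<Sum>u\<in>UNIV. \<Sum>w\<in>UNIV. g u * char2 (u * L w))"
    by (rule sum.swap)
  also have "\<dots> = (\<Sum>u\<in>UNIV. g u * (\<Sum>w\<in>UNIV. char2 (u * L w)))"
    by (simp add: sum_distrib_left)
  also have "\<dots> = (\<Sum>u\<in>UNIV. g u * (\<Sum>z\<in>UNIV. char2 (u * z)))"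
    by (simp only: sum.reindex_bij_betw[OF L, of "\<lambda>z. char2 (_ * z)"])
  also have "\<dots> = (\<Sum>u\<in>(UNIV :: 'f set). if u = 0 then of_nat CARD('f) else 0)"
    by (rule sum.cong) (simp_all add: sum_char2' \<open>g 0 = 1\<close>)
  also have "\<dots> = complex_of_real (real CARD('f))" by simp
  finally show ?thesis by (simp only: of_real_eq_iff)
qed

end

section \<open>Mutually unbiased families\<close>

lemma herm_sum_left: "herm (\<Sum>x\<in>S. u x *s x) y = (\<Sum>x\<in>S. u x * herm x y)"
proof -
  have "herm (\<Sum>x\<in>S. u x *s x) y = (\<Sum>w\<in>UNIV. \<Sum>x\<in>S. u x * (x $ w * cnj (y $ w)))"
    by (simp add: herm_def sum_distrib_right mult.assoc)
  also have "\<dots> = (\<Sum>x\<in>S. \<Sum>w\<in>UNIV. u x * (x $ w * cnj (y $ w)))"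
    by (rule sum.swap)
  finally show ?thesis by (simp add: herm_def sum_distrib_left)
qed

lemma orthonormal_basis_range:
  fixes b :: "'n::finite \<Rightarrow> complex ^ 'n"
  assumes b: "\<And>v w. herm (b v) (b w) = (if v = w then 1 else 0)"
  shows "orthonormal_basis (range b)"
proof -
  have inj: "inj b" using b by (metis injI zero_neq_one)
  have indep: "vec.independent (range b)"
    unfolding vec.independent_explicit_finite_subsets
  proof (intro allI impI ballI)
    fix S u v assume S: "S \<subseteq> range b" "finite S" "(\<Sum>x\<in>S. u x *s x) = 0" "v \<in> S"
    have herm: "herm x v = (if x = v then 1 else 0)" if x: "x \<in> S" for x
    proof -
      obtain i j where "x = b i" "v = b j" using S x by blast
      then show ?thesis using b inj by (simp add: inj_eq)
    qed
    have "0 = (\<Sum>x\<in>S. u x * herm x v)"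
      using S herm_sum_left[of u S v] by (simp add: herm_def)
    also have "\<dots> = (\<Sum>x\<in>S. if x = v then u x else 0)"
      by (rule sum.cong) (simp_all add: herm)
    also have "\<dots> = u v" using S by simp
    finally show "u v = 0" by simp
  qed
  have "card (range b) = CARD('n)" using inj by (rule card_image)
  then have "vec.span (range b) = UNIV"
    using vec.card_eq_dim[of "range b" UNIV] indep by (auto simp: card_cart_basis)
  then show ?thesis
    unfolding orthonormal_basis_def using indep b inj by (auto dest: injD)
qed

lemma complete_set_of_MUBs_range:
  fixes b :: "'k::finite \<Rightarrow> 'n::finite \<Rightarrow> complex ^ 'n"
  assumes card: "CARD('k) = CARD('n) + 1" "1 < CARD('n)"
    and orth: "\<And>k v w. herm (b k v) (b k w) = (if v = w then 1 else 0)"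
    and unbiased: "\<And>k l v w. k \<noteq> l \<Longrightarrow> (cmod (herm (b k v) (b l w)))\<^sup>2 = 1 / real CARD('n)"
  shows "complete_set_of_MUBs (range (\<lambda>k. range (b k)))"
proof -
  \<comment> \<open>The bases are counted as sets, so distinct indices must give distinct sets. A
    vector common to two of them would have squared inner product with itself equal both to 1 and to
    \<open>1 / CARD('n)\<close>.\<close>
  have "k = l" if eq: "range (b k) = range (b l)" for k l
  proof (rule ccontr)
    assume "k \<noteq> l"
    obtain v w where "b k v = b l w" using eq by (metis rangeE rangeI)
    then have "(1::real) = 1 / real CARD('n)"
      using unbiased[OF \<open>k \<noteq> l\<close>, of v w] orth[of l w w] by simp
    then show False using card(2) by simp
  qed
  then have "inj (\<lambda>k. range (b k))" by (rule injI)
  then have "card (range (\<lambda>k. range (b k))) = CARD('n) + 1"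
    using card(1) by (simp add: card_image)
  moreover have "(cmod (herm x y))\<^sup>2 = 1 / real CARD('n)"
    if "range (b k) \<noteq> range (b l)" "x \<in> range (b k)" "y \<in> range (b l)" for k l x y
  proof -
    have "k \<noteq> l" using that by auto
    then show ?thesis using that unbiased by blast
  qed
  ultimately show ?thesis
    unfolding complete_set_of_MUBs_def using orthonormal_basis_range[OF orth] by blast
qed

section \<open>The quadratic forms of a symplectic presemifield\<close>

locale symplectic_galois_ring = galois_ring_character r red \<omega>
  for r :: nat and red :: "'r::{comm_ring_1,finite} \<Rightarrow> 'f::finite_field" and \<omega> :: complex +
  fixes mul :: "'f \<Rightarrow> 'f \<Rightarrow> 'f" and a :: "nat \<Rightarrow> nat \<Rightarrow> 'f"
  assumes symplectic: "symplectic_presemifield r mul" and expansion: "has_expansion r mul a"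
begin

lemma mul_eq: "mul x y = (\<Sum>i<r. \<Sum>j<r. a i j * x ^ 2 ^ i * y ^ 2 ^ j)"
  using expansion by (simp add: has_expansion_def)

lemma mul_add_left: "mul (x + y) z = mul x z + mul y z"
  and mul_add_right: "mul x (y + z) = mul x y + mul x z"
  and mul_eq_0: "mul x y = 0 \<Longrightarrow> x = 0 \<or> y = 0"
  using symplectic by (simp_all add: symplectic_presemifield_def presemifield_def)

lemma trace_mul_commute: "abs_trace r (x * mul y z) = abs_trace r (y * mul x z)"
proof -
  have "totally_isotropic r {(x, mul x z) | x. True}"
    using symplectic by (simp add: symplectic_presemifield_def)
  then have "abs_trace r (x * mul y z - mul x z * y) = 0"
    unfolding totally_isotropic_def symp_form_def by force
  then have "abs_trace r (x * mul y z) + abs_trace r (y * mul x z) = 0"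
    by (simp only: diff_conv_add_uminus uminus_eq_self[OF card_field] abs_trace_add[OF card_field]
        mult.commute[of _ y])
  then have "abs_trace r (x * mul y z) = - abs_trace r (y * mul x z)"
    by (simp only: eq_neg_iff_add_eq_0)
  then show ?thesis by (simp only: uminus_eq_self[OF card_field])
qed

lemma coeffs_adjoint:
  "i < r \<Longrightarrow> j < r \<Longrightarrow> a ((r - i) mod r) ((r - i + j) mod r) = a i j ^ 2 ^ (r - i)"
  using symplectic_coeffs[OF card_field expansion trace_mul_commute] .

text \<open>It agrees with \<open>ext_mul\<close> on lifts, where iterates of \<open>frob\<close>
  are powers, and is additive in \<open>x\<close> on the whole ring.\<close>

definition lift_mul :: "'f \<Rightarrow> 'r \<Rightarrow> 'r" where
  "lift_mul m x = (\<Sum>i<r. \<Sum>j<r. teich (a i j) * (frob ^^ i) x * teich (m ^ 2 ^ j))"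

lemma ext_mul_eq: "ext_mul r red a (teich w) (teich m) = lift_mul m (teich w)"
  by (simp add: ext_mul_def lift_mul_def teichmueller_lift_eq frob_pow_teich teich_power)

lemma red_lift_mul: "red (lift_mul m x) = mul (red x) m"
  by (simp add: lift_mul_def mul_eq)

lemma lift_mul_add: "lift_mul m (x + y) = lift_mul m x + lift_mul m y"
  by (simp add: lift_mul_def frob_pow_add distrib_left distrib_right sum.distrib)

text \<open>The relation between the coefficients lifts to the Teichmueller set because it is
  multiplicative, so the symmetry holds modulo 4 and not only modulo 2.\<close>

lemma galois_trace_lift_mul_commute:
  "galois_trace r (x * lift_mul m y) = galois_trace r (y * lift_mul m x)"
proof -
  have term_adjoint: "galois_trace r (x * (teich (a i j) * (frob ^^ i) y * teich (m ^ 2 ^ j)))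
      = galois_trace r (y * (teich (a ((r - i) mod r) ((r - i + j) mod r))
          * (frob ^^ ((r - i) mod r)) x * teich (m ^ 2 ^ ((r - i + j) mod r))))"
    (is "galois_trace r ?s = galois_trace r ?t") if ij: "i < r" "j < r" for i j
  proof -
    have "(frob ^^ (r - i)) ((frob ^^ i) y) = (frob ^^ (r - i + i)) y"
      by (simp only: funpow_add o_apply)
    then have y: "(frob ^^ (r - i)) ((frob ^^ i) y) = y"
      using ij frob_pow_period by simp
    have m: "(m ^ 2 ^ j) ^ 2 ^ (r - i) = m ^ 2 ^ ((r - i + j) mod r)"
      by (simp only: power_two_power_mod[OF card_field] power_mult[symmetric]
          power_add[symmetric] add.commute)
    \<comment> \<open>The trace does not see this automorphism. It completes the \<open>i\<close>
      iterations on \<open>y\<close> to a full period, transfers the remaining ones to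
      \<open>x\<close>, and sends the lifted coefficient to the lift of the adjoint one.\<close>
    have "(frob ^^ (r - i)) ?s = ?t"
      by (simp only: frob_pow_mult frob_pow_teich y m coeffs_adjoint[OF ij] frob_pow_mod mult_ac)
    then show ?thesis by (metis galois_trace_frob_pow)
  qed
  have "galois_trace r (x * lift_mul m y) = (\<Sum>i<r. \<Sum>j<r.
      galois_trace r (x * (teich (a i j) * (frob ^^ i) y * teich (m ^ 2 ^ j))))"
    by (simp only: lift_mul_def sum_distrib_left galois_trace_sum)
  also have "\<dots> = (\<Sum>i<r. \<Sum>j<r. galois_trace r (y * (teich (a ((r - i) mod r) ((r - i + j) mod r))
          * (frob ^^ ((r - i) mod r)) x * teich (m ^ 2 ^ ((r - i + j) mod r)))))"
    by (intro sum.cong refl term_adjoint) simp_all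
  also have "\<dots> = (\<Sum>i<r. \<Sum>j<r.
      galois_trace r (y * (teich (a i j) * (frob ^^ i) x * teich (m ^ 2 ^ j))))"
    by (rule sum_adjoint_index)
  also have "\<dots> = galois_trace r (y * lift_mul m x)"
    by (simp only: lift_mul_def sum_distrib_left galois_trace_sum)
  finally show ?thesis .
qed

lemma char4_lift_mul_commute: "char4 (x * lift_mul m y) = char4 (y * lift_mul m x)"
  by (simp only: char4_def galois_trace_lift_mul_commute[of x])

definition qform :: "'f \<Rightarrow> 'f \<Rightarrow> complex" where
  "qform m w = char4 (teich w * lift_mul m (teich w))"

lemma norm_qform [simp]: "cmod (qform m w) = 1"
  by (simp add: qform_def)

lemma char4_square_add:
  "char4 ((x + y) * lift_mul m (x + y))
    = char4 (x * lift_mul m x) * char4 (y * lift_mul m y) * char4 (y * lift_mul m x) ^ 2"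
proof -
  have "char4 ((x + y) * lift_mul m (x + y)) = char4 (x * lift_mul m x) * char4 (x * lift_mul m y)
      * (char4 (y * lift_mul m x) * char4 (y * lift_mul m y))"
    by (simp only: lift_mul_add distrib_left distrib_right char4_add mult_ac)
  also have "char4 (x * lift_mul m y) = char4 (y * lift_mul m x)"
    by (rule char4_lift_mul_commute)
  finally show ?thesis by (simp only: power2_eq_square mult_ac)
qed

lemma qform_add: "qform m (w + u) = qform m w * qform m u * char2 (u * mul w m)"
proof -
  define s where "s = teich w + teich u"
  define t where "t = teich ((w * u) ^ 2 ^ (r - 1))"
  have lift_double: "lift_mul m (2 * t) = 2 * lift_mul m t"
    by (simp only: mult_2 lift_mul_add)
  have "qform m (w + u) = char4 ((s + 2 * t) * lift_mul m (s + 2 * t))"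
    by (simp only: qform_def teich_add s_def t_def)
  \<comment> \<open>The term quadratic in \<open>2 * t\<close> has the factor 4 outright. The cross
    term gets one factor 2 from \<open>2 * t\<close> and one from the symmetry of the form, so it
    becomes a fourth power of a character value.\<close>
  also have "\<dots> = char4 (s * lift_mul m s) * char4 (2 * (2 * (t * lift_mul m t)))
      * char4 (2 * (t * lift_mul m s)) ^ 2"
    by (simp only: char4_square_add lift_double) (simp only: mult_ac)
  also have "\<dots> = char4 (s * lift_mul m s) * char4 (t * lift_mul m s) ^ 4"
    by (simp only: two_mult_two char4_0 char4_double power_mult[symmetric]) simp
  also have "\<dots> = char4 (s * lift_mul m s)" by (simp only: char4_power_4 mult_1_right)
  also have "\<dots> = qform m w * qform m u * char4 (2 * (teich u * lift_mul m (teich w)))"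
    by (simp only: s_def char4_square_add qform_def char4_double)
  also have "char4 (2 * (teich u * lift_mul m (teich w))) = char2 (u * mul w m)"
    by (simp only: char4_double_eq_char2 red_mult red_teich red_lift_mul)
  finally show ?thesis .
qed

section \<open>Inner products of the basis vectors\<close>

lemma basis_vec_nth:
  "basis_vec \<omega> r red a m v $ w = qform m w * char2 (w * v) / sqrt (real CARD('f))"
proof -
  have "z4_pow \<omega> (galois_trace r (teich w * lift_mul m (teich w) + 2 * teich w * teich v))
      = qform m w * char2 (w * v)" for w
    using char4_add by (simp add: char2_def qform_def teich_mult mult.assoc flip: char4_def)
  then show ?thesis
    by (simp add: basis_vec_def teichmueller_lift_eq ext_mul_eq axis_def if_distrib cong: if_cong)
qed

text \<open>Conjugation fixes the values of \<open>char2\<close>, which is why \<open>v\<close> and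
  \<open>v'\<close> are added.\<close>

lemma herm_basis_vec:
  "herm (basis_vec \<omega> r red a m v) (basis_vec \<omega> r red a m' v')
    = (\<Sum>w\<in>UNIV. qform m w * cnj (qform m' w) * char2 (w * (v + v'))) / real CARD('f)"
proof -
  have "complex_of_real (sqrt (real CARD('f))) * complex_of_real (sqrt (real CARD('f)))
      = of_nat CARD('f)"
    by (simp flip: of_real_mult)
  then show ?thesis
    by (simp add: herm_def basis_vec_nth sum_divide_distrib distrib_left char2_add mult_ac)
qed

lemma herm_basis_vec_same:
  "herm (basis_vec \<omega> r red a m v) (basis_vec \<omega> r red a m v') = (if v = v' then 1 else 0)"
proof -
  have "qform m w * cnj (qform m w) = 1" for w by (rule mult_cnj_eq_1) simp
  then have "herm (basis_vec \<omega> r red a m v) (basis_vec \<omega> r red a m v')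
      = (if v + v' = 0 then of_nat CARD('f) else 0) / real CARD('f)"
    by (simp add: herm_basis_vec sum_char2)
  moreover have "v + v' = 0 \<longleftrightarrow> v = v'"
    by (metis add_self_eq_zero[OF card_field] add_right_cancel)
  ultimately show ?thesis by simp
qed

lemma bij_mul:
  assumes "d \<noteq> 0"
  shows "bij (\<lambda>w. mul w d)"
proof -
  have "inj (\<lambda>w. mul w d)"
  proof (rule injI)
    fix x y assume "mul x d = mul y d"
    then have "mul (x + y) d = 0" by (simp add: mul_add_left add_self_eq_zero[OF card_field])
    then have "x + y = 0" using mul_eq_0 assms by blast
    then show "x = y" by (metis add_self_eq_zero[OF card_field] add_right_cancel)
  qed
  then show ?thesis by (simp add: bij_def finite_UNIV_inj_surj)
qed

lemma herm_basis_vec_distinct: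
  assumes "m \<noteq> m'"
  shows "(cmod (herm (basis_vec \<omega> r red a m v) (basis_vec \<omega> r red a m' v')))\<^sup>2 = 1 / real CARD('f)"
proof -
  define g where "g w = qform m w * cnj (qform m' w) * char2 (w * (v + v'))" for w
  have "m + m' \<noteq> 0"
    using assms by (metis add_self_eq_zero[OF card_field] add_right_cancel)
  then have "bij (\<lambda>w. mul w (m + m'))" by (rule bij_mul)
  moreover have "cmod (g w) = 1" for w by (simp add: g_def norm_mult)
  \<comment> \<open>The factor \<open>char2 (w * (v + v'))\<close> is multiplicative in
    \<open>w\<close> and leaves the polarization alone. The polarization of the conjugated form is
    real, so the two combine into that of \<open>m + m'\<close> by additivity of \<open>mul\<close>
    in its second argument.\<close>
  moreover have "g (w + u) = g w * g u * char2 (u * mul w (m + m'))" for w u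
    by (simp add: g_def qform_add mul_add_right distrib_left distrib_right char2_add mult_ac)
  ultimately have "(cmod (\<Sum>w\<in>UNIV. g w))\<^sup>2 = real CARD('f)"
    using norm_quadratic_sum[of g "\<lambda>w. mul w (m + m')"] by blast
  then show ?thesis
    unfolding herm_basis_vec g_def[symmetric]
    by (simp add: norm_divide power_divide power2_eq_square[of "real _"])
qed

lemma complete_set_of_MUBs_basis_of:
  "complete_set_of_MUBs (insert basis_infinity {basis_of \<omega> r red a m | m. True})"
proof -
  \<comment> \<open>Type \<open>option\<close> supplies exactly one index beyond the field, so all
    pairs of bases fall under one lemma.\<close>
  define b where "b k v = (case k of None \<Rightarrow> axis v 1 | Some m \<Rightarrow> basis_vec \<omega> r red a m v)"
    for k :: "'f option" and v :: 'f
  \<comment> \<open>Against the standard basis an inner product is a single coordinate up to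
    conjugation, so unbiasedness there only asks for coordinates of constant modulus.\<close>
  have norm_nth: "(cmod (basis_vec \<omega> r red a m v $ w))\<^sup>2 = 1 / real CARD('f)" for m v w
    by (simp add: basis_vec_nth norm_mult norm_divide power_divide)
  have herm_axis: "herm (axis v 1) x = cnj (x $ v)" "herm x (axis v 1) = x $ v"
    for v :: 'f and x
    by (simp_all add: herm_def axis_def if_distrib[of cnj] if_distrib[of "\<lambda>y. y * _"]
        if_distrib[of "\<lambda>y. _ * y"] cong: if_cong)
  have axis_nth: "axis v 1 $ w = (if w = v then 1 else 0)" for v w :: 'f
    by (simp add: axis_def)
  have "complete_set_of_MUBs (range (\<lambda>k. range (b k)))"
  proof (rule complete_set_of_MUBs_range)
    show "CARD('f option) = CARD('f) + 1" by simp
    show "1 < CARD('f)" unfolding card_field by (rule one_less_power) simp_all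
    fix k l v w
    show "herm (b k v) (b k w) = (if v = w then 1 else 0)"
      by (cases k) (simp_all add: b_def herm_basis_vec_same herm_axis axis_nth)
    show "(cmod (herm (b k v) (b l w)))\<^sup>2 = 1 / real CARD('f)" if "k \<noteq> l"
      using that
      by (cases k; cases l) (simp_all add: b_def herm_axis norm_nth herm_basis_vec_distinct)
  qed
  moreover have "range (b None) = basis_infinity" "range (b (Some m)) = basis_of \<omega> r red a m" for m
    by (auto simp: b_def basis_infinity_def basis_of_def)
  then have "range (\<lambda>k. range (b k)) = insert basis_infinity {basis_of \<omega> r red a m | m. True}"
    by (simp add: UNIV_option_conv image_image full_SetCompr_eq)
  ultimately show ?thesis by simp
qed

end

theorem theorem4p2:
  fixes r :: nat
    and mul :: "'f::finite_field \<Rightarrow> 'f \<Rightarrow> 'f"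
    and red :: "'r::{comm_ring_1,finite} \<Rightarrow> 'f"
    and \<omega> :: complex
  assumes "CARD('f) = 2 ^ r"
    and "symplectic_presemifield r mul"
    and "galois_ring_4 r red"
    and "primitive_4th_root \<omega>"
  shows "(\<exists>!a. has_expansion r mul a) \<and>
    (\<forall>a. has_expansion r mul a \<longrightarrow>
      complete_set_of_MUBs (insert basis_infinity {basis_of \<omega> r red a m | m. True}))"
proof (intro conjI allI impI)
  show "\<exists>!a. has_expansion r mul a"
    using assms(1,2) by (intro has_expansion_ex1) (simp_all add: symplectic_presemifield_def)
next
  fix a assume "has_expansion r mul a"
  with assms interpret symplectic_galois_ring r red \<omega> mul a
    by unfold_locales
  show "complete_set_of_MUBs (insert basis_infinity {basis_of \<omega> r red a m | m. True})"
    by (rule complete_set_of_MUBs_basis_of)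
qed

end
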